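(* Let $n\ge 5$ be an integer. (a) There exists a POTB with three factors, each having $n+1$ levels, on $b=6n$ blocks of size $2$ each. (b) In the case $n=5$ one gets a balanced POTB which is not a PERGOLA; that is, there exists a balanced POTB with three factors, each having $6$ levels, on $30$ blocks of size $2$ each, such that none of the two-factor balanced POTBs obtained from it by ignoring one of the three factors is a PERGOLA.
   Context: Let $b,k,m\ge 1$ be integers. A blocked main effect plan (MEP) with $m$ factors $F_1,\dots,F_m$ on $b$ blocks of size $k$ each is an $(m+1)\times bk$ array, with rows indexed $0,1,\dots,m$. The entries of row $0$ (the block factor $B$) lie in $\{1,\dots,b\}$ and each $j\in\{1,\dots,b\}$ appears exactly $k$ times in row $0$. For $1\le i\le m$ the entries of row $i$ lie in a set $S_i$ of size $s_i$, and $F_i$ is said to have $s_i$ levels (the elements of $S_i$). Each column is a run (plot); columns with entry $j$ in row $0$ form the $j$th block. Columns may be repeated. For $1\le i,j\le m$, $M_{ij}$ is the $s_i\times s_j$ matrix whose $(p,q)$ entry is the number of columns whose $i$th entry is $p$ and $j$th entry is $q$ ($p\in S_i,q\in S_j$). $M_{iB}$ is the $s_i\times b$ matrix whose $(p,j)$ entry is the number of columns whose $i$th entry is $p$ and whose row-$0$ entry is $j$. Factors $F_i,F_j$ ($i\ne j$) are orthogonal through the block factor if $M_{iB}(M_{jB})'=k\,M_{ij}$ (prime denotes transpose). A POTB (plan orthogonal through the block factor) is a blocked MEP in which every pair of distinct factors is orthogonal through the block factor. A blocked MEP is connected if, for each $i$, $M_{iB}$ is the incidence matrix of a connected block design, i.e.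 the graph on $S_i$ in which two levels are adjacent when some block contains both is connected. A connected POTB is balanced if for each $i$, $M_{iB}$ is the treatment-versus-block incidence matrix of a balanced incomplete block design (BIBD). A PERGOLA (perfect Graeco-Latin balanced incomplete block design) is a two-factor balanced POTB with $s_1=s_2=s$ such that $M_{12}M_{12}'=M_{12}'M_{12}=fI_s+gJ_s$ for some integers $f,g$, where $I_s$ is the identity matrix and $J_s$ the all-one matrix of order $s$. *)

theory Defs
  imports "Jordan_Normal_Form.Matrix"
begin

text \<open>A plan on \<open>b\<close> blocks of size \<open>k\<close> with \<open>m\<close> factors is a pair \<open>(S, A)\<close>: \<open>A\<close> is the
  array, whose columns are indexed by \<open>0, \<dots>, b * k - 1\<close>, and \<open>S i\<close> is the set of levels of
  the factor in row \<open>i\<close>. Levels are natural numbers, which only fixes names for the elements of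
  the finite level sets. The value \<open>S 0\<close> is never used.\<close>

definition blocked_mep :: "nat \<Rightarrow> nat \<Rightarrow> nat \<Rightarrow> (nat \<Rightarrow> nat set) \<Rightarrow> nat mat \<Rightarrow> bool" where
  "blocked_mep m b k S A \<longleftrightarrow>
     1 \<le> m \<and> 1 \<le> b \<and> 1 \<le> k \<and>
     A \<in> carrier_mat (m + 1) (b * k) \<and>
     (\<forall>c<b * k. A $$ (0, c) \<in> {1..b}) \<and>
     (\<forall>j\<in>{1..b}. card {c. c < b * k \<and> A $$ (0, c) = j} = k) \<and>
     (\<forall>i\<in>{1..m}. finite (S i) \<and> (\<forall>c<b * k. A $$ (i, c) \<in> S i))"

text \<open>Library matrices are indexed from \<open>0\<close>, so the rows and columns belonging to \<open>S i\<close> are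
  listed in increasing order of the levels, and column \<open>j\<close> of \<open>M_block\<close> belongs to the
  block labelled \<open>j + 1\<close>.\<close>

definition level :: "(nat \<Rightarrow> nat set) \<Rightarrow> nat \<Rightarrow> nat \<Rightarrow> nat" where
  "level S i p = sorted_list_of_set (S i) ! p"

definition M_factors :: "(nat \<Rightarrow> nat set) \<Rightarrow> nat mat \<Rightarrow> nat \<Rightarrow> nat \<Rightarrow> int mat" where
  "M_factors S A i j = mat (card (S i)) (card (S j)) (\<lambda>(p, q).
     int (card {c. c < dim_col A \<and> A $$ (i, c) = level S i p \<and> A $$ (j, c) = level S j q}))"

definition M_block :: "nat \<Rightarrow> (nat \<Rightarrow> nat set) \<Rightarrow> nat mat \<Rightarrow> nat \<Rightarrow> int mat" where
  "M_block b S A i = mat (card (S i)) b (\<lambda>(p, j).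
     int (card {c. c < dim_col A \<and> A $$ (i, c) = level S i p \<and> A $$ (0, c) = j + 1}))"

definition orthogonal_through_block ::
    "nat \<Rightarrow> nat \<Rightarrow> (nat \<Rightarrow> nat set) \<Rightarrow> nat mat \<Rightarrow> nat \<Rightarrow> nat \<Rightarrow> bool" where
  "orthogonal_through_block b k S A i j \<longleftrightarrow>
     M_block b S A i * transpose_mat (M_block b S A j) = int k \<cdot>\<^sub>m M_factors S A i j"

definition potb :: "nat \<Rightarrow> nat \<Rightarrow> nat \<Rightarrow> (nat \<Rightarrow> nat set) \<Rightarrow> nat mat \<Rightarrow> bool" where
  "potb m b k S A \<longleftrightarrow> blocked_mep m b k S A \<and>
     (\<forall>i\<in>{1..m}. \<forall>j\<in>{1..m}. i \<noteq> j \<longrightarrow> orthogonal_through_block b k S A i j)"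

text \<open>The rows of a treatment-versus-block matrix \<open>N\<close> are the treatments, and
  \<open>N $$ (p, j)\<close> counts the occurrences of treatment \<open>p\<close> in block \<open>j\<close>.\<close>

definition adjacent :: "int mat \<Rightarrow> (nat \<times> nat) set" where
  "adjacent N = {(p, q). p < dim_row N \<and> q < dim_row N \<and>
     (\<exists>j<dim_col N. N $$ (p, j) > 0 \<and> N $$ (q, j) > 0)}"

definition connected_design :: "int mat \<Rightarrow> bool" where
  "connected_design N \<longleftrightarrow> (\<forall>p<dim_row N. \<forall>q<dim_row N. (p, q) \<in> (adjacent N)\<^sup>*)"

definition connected_mep :: "nat \<Rightarrow> nat \<Rightarrow> nat \<Rightarrow> (nat \<Rightarrow> nat set) \<Rightarrow> nat mat \<Rightarrow> bool" where
  "connected_mep m b k S A \<longleftrightarrow>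
     blocked_mep m b k S A \<and> (\<forall>i\<in>{1..m}. connected_design (M_block b S A i))"

text \<open>A BIBD with point set \<open>{..<v}\<close>; the blocks form an indexed family, so that repeated
  blocks are allowed.\<close>

definition bibd :: "nat \<Rightarrow> nat \<Rightarrow> nat \<Rightarrow> nat \<Rightarrow> nat \<Rightarrow> (nat \<Rightarrow> nat set) \<Rightarrow> bool" where
  "bibd v b r k lam Bl \<longleftrightarrow>
     2 \<le> k \<and> k < v \<and>
     (\<forall>j<b. Bl j \<subseteq> {..<v} \<and> card (Bl j) = k) \<and>
     (\<forall>p<v. card {j. j < b \<and> p \<in> Bl j} = r) \<and>
     (\<forall>p<v. \<forall>q<v. p \<noteq> q \<longrightarrow> card {j. j < b \<and> p \<in> Bl j \<and> q \<in> Bl j} = lam)"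

definition incidence_mat :: "nat \<Rightarrow> nat \<Rightarrow> (nat \<Rightarrow> nat set) \<Rightarrow> int mat" where
  "incidence_mat v b Bl = mat v b (\<lambda>(p, j). if p \<in> Bl j then 1 else 0)"

definition balanced_potb :: "nat \<Rightarrow> nat \<Rightarrow> nat \<Rightarrow> (nat \<Rightarrow> nat set) \<Rightarrow> nat mat \<Rightarrow> bool" where
  "balanced_potb m b k S A \<longleftrightarrow>
     potb m b k S A \<and> connected_mep m b k S A \<and>
     (\<forall>i\<in>{1..m}. \<exists>r lam Bl. bibd (card (S i)) b r k lam Bl \<and>
        M_block b S A i = incidence_mat (card (S i)) b Bl)"

text \<open>The equation \<open>M * M' = M' * M\<close> identifies the two level sets along their enumerations,
  but since both sides equal \<open>f I + g J\<close>, the condition does not depend on this identification.\<close>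

definition pergola :: "nat \<Rightarrow> nat \<Rightarrow> (nat \<Rightarrow> nat set) \<Rightarrow> nat mat \<Rightarrow> bool" where
  "pergola b k S A \<longleftrightarrow>
     balanced_potb 2 b k S A \<and>
     (\<exists>s f g. card (S 1) = s \<and> card (S 2) = s \<and>
        (let M = M_factors S A 1 2 in
           M * transpose_mat M = transpose_mat M * M \<and>
           transpose_mat M * M = f \<cdot>\<^sub>m 1\<^sub>m s + g \<cdot>\<^sub>m mat s s (\<lambda>_. 1)))"

text \<open>Ignoring the factor in row \<open>l\<close>: the rows below it move up by one.\<close>

definition skip :: "nat \<Rightarrow> nat \<Rightarrow> nat" where
  "skip l i = (if i < l then i else i + 1)"

definition drop_levels :: "nat \<Rightarrow> (nat \<Rightarrow> nat set) \<Rightarrow> nat \<Rightarrow> nat set" where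
  "drop_levels l S = (\<lambda>i. S (skip l i))"

definition drop_row :: "nat \<Rightarrow> nat mat \<Rightarrow> nat mat" where
  "drop_row l A = mat (dim_row A - 1) (dim_col A) (\<lambda>(i, c). A $$ (skip l i, c))"

lemma M_block_drop:
  assumes "l \<ge> 1" "A \<in> carrier_mat (m + 2) N" "i \<le> m"
  shows "M_block b (drop_levels l S) (drop_row l A) i = M_block b S A (skip l i)"
  using assms unfolding M_block_def
  by (intro cong_mat) (auto simp: drop_levels_def drop_row_def level_def skip_def intro!: arg_cong[where f = card])

lemma M_factors_drop:
  assumes "A \<in> carrier_mat (m + 2) N" "i \<le> m" "j \<le> m"
  shows "M_factors (drop_levels l S) (drop_row l A) i j = M_factors S A (skip l i) (skip l j)"
  using assms unfolding M_factors_def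
  by (intro cong_mat) (auto simp: drop_levels_def drop_row_def level_def intro!: arg_cong[where f = card])

lemma balanced_potb_drop:
  assumes P: "balanced_potb (m + 1) b k S A" and m: "m \<ge> 1" and l: "l \<in> {1..m + 1}"
  shows "balanced_potb m b k (drop_levels l S) (drop_row l A)"
proof -
  have A: "A \<in> carrier_mat (m + 2) (b * k)"
    using P by (auto simp: balanced_potb_def potb_def blocked_mep_def)
  have sk: "skip l i \<in> {1..m + 1}" if "i \<in> {1..m}" for i
    using that by (auto simp: skip_def)
  have inj: "skip l i \<noteq> skip l j" if "i \<noteq> j" for i j
    using that by (auto simp: skip_def)
  have ent: "drop_row l A $$ (i, c) = A $$ (skip l i, c)" if "i \<le> m" "c < b * k" for i c
    using that A by (auto simp: drop_row_def)
  have sk0: "skip l 0 = 0" using l by (auto simp: skip_def)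
  have mep: "blocked_mep m b k (drop_levels l S) (drop_row l A)"
  proof -
    have B: "blocked_mep (m + 1) b k S A"
      using P by (auto simp: balanced_potb_def potb_def)
    have car: "drop_row l A \<in> carrier_mat (m + 1) (b * k)"
      using A by (auto simp: drop_row_def)
    have "{c. c < b * k \<and> drop_row l A $$ (0, c) = j} = {c. c < b * k \<and> A $$ (0, c) = j}" for j
      using ent[of 0] sk0 by auto
    then show ?thesis
      using B m car ent sk sk0 unfolding blocked_mep_def by (simp add: drop_levels_def)
  qed
  have MB: "M_block b (drop_levels l S) (drop_row l A) i = M_block b S A (skip l i)"
    if "i \<in> {1..m}" for i
    using M_block_drop[OF _ A] that l by simp
  have MF: "M_factors (drop_levels l S) (drop_row l A) i j = M_factors S A (skip l i) (skip l j)"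
    if "i \<in> {1..m}" "j \<in> {1..m}" for i j
    using M_factors_drop[OF A] that by simp
  have O: "orthogonal_through_block b k S A (skip l i) (skip l j)"
    if "i \<in> {1..m}" "j \<in> {1..m}" "i \<noteq> j" for i j
    using P sk[OF that(1)] sk[OF that(2)] inj[OF that(3)]
    unfolding balanced_potb_def potb_def by blast
  have C: "connected_design (M_block b S A (skip l i))"
    and D: "\<exists>r lam Bl. bibd (card (S (skip l i))) b r k lam Bl \<and>
        M_block b S A (skip l i) = incidence_mat (card (S (skip l i))) b Bl"
    if "i \<in> {1..m}" for i
    using P sk[OF that] unfolding balanced_potb_def connected_mep_def by blast+
  have card_eq: "card (drop_levels l S i) = card (S (skip l i))" for i
    by (simp add: drop_levels_def)
  show ?thesis
    unfolding balanced_potb_def potb_def connected_mep_def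
  proof (intro conjI ballI impI)
    fix i j assume "i \<in> {1..m}" "j \<in> {1..m}" "i \<noteq> j"
    then show "orthogonal_through_block b k (drop_levels l S) (drop_row l A) i j"
      using O[of i j] MB[of i] MB[of j] MF[of i j]
      unfolding orthogonal_through_block_def by metis
  next
    fix i assume i: "i \<in> {1..m}"
    show "connected_design (M_block b (drop_levels l S) (drop_row l A) i)"
      using C[OF i] MB[OF i] by metis
    show "\<exists>r lam Bl. bibd (card (drop_levels l S i)) b r k lam Bl \<and>
        M_block b (drop_levels l S) (drop_row l A) i =
          incidence_mat (card (drop_levels l S i)) b Bl"
      using D[OF i] unfolding MB[OF i] card_eq .
  qed (fact mep)+
qed

end

theory Submission
  imports Defs
begin

text \<open>
  One family of cyclic plans serves both claims. The levels of every factor are the residues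
  modulo \<open>n\<close> together with a fixed point \<open>\<infinity>\<close>, and six initial blocks of two runs are
  translated by all residues, which gives \<open>6 n\<close> blocks.

  On a block with levels \<open>a, a'\<close> of one factor and \<open>b, b'\<close> of another, write \<open>e\<^sub>a\<close> for the unit
  vector of a level. Since \<open>(x + x') (y + y') = 2 (x y + x' y') - (x - x') (y - y')\<close>, the two
  factors are orthogonal through blocks of size two exactly when the products of contrasts
  \<open>(e\<^sub>a - e\<^bsub>a'\<^esub>) \<otimes> (e\<^sub>b - e\<^bsub>b'\<^esub>)\<close> sum to zero over all blocks; the lemma
  \<open>orthogonal_through_block_contrasts\<close> is the direction used here. For a cyclic plan that sum is
  determined by the joint frequencies of two base levels over all translates, and these are
  unchanged when both base levels are moved by one (\<open>joint_frequency_Suc\<close>). Hence orthogonality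
  is a finite cancellation between the initial blocks, the same for every \<open>n\<close>.

  The cancellation is visible in Laurent polynomials: let \<open>x ^ a\<close> stand for the residue \<open>a\<close>, and
  let translation invariance turn \<open>u \<otimes> v\<close> into \<open>u(x) v(1 / x)\<close>. Group the initial blocks in
  consecutive pairs.
  \<^item> Factors 1 and 2: within each pair, after a common translation, the contrasts of factor 1 agree
    and those of factor 2 are opposite.
  \<^item> Factors 1 and 3: the first pair cancels in the same way, and the other two contribute
    \<open>(1 - x)\<^sup>2 (1 - 1/x\<^sup>2)\<close> and its negative.
  \<^item> Factors 2 and 3: the three pairs contribute \<open>1 - 1/x\<^sup>2\<close> times \<open>- 2\<close>, \<open>1 + x\<close> and \<open>1 - x\<close>.

  In each factor the six initial pairs of levels contain \<open>\<infinity>\<close> twice, have difference \<open>1\<close> or \<open>- 1\<close>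
  twice and difference \<open>2\<close> or \<open>- 2\<close> twice. For \<open>n = 5\<close> these exhaust the nonzero differences, so
  any two of the six levels meet in exactly two blocks and the plan is balanced. It contains no
  PERGOLA: \<open>f I + g J\<close> has a constant off-diagonal, whereas in every \<open>M' M\<close> the entry of columns
  \<open>0\<close> and \<open>1\<close> differs from the entry of columns \<open>0\<close> and \<open>\<infinity>\<close>.
\<close>

section \<open>Orthogonality on blocks of size two\<close>

lemma sum_lessThan_times_add:
  fixes f :: "nat \<Rightarrow> 'a :: comm_monoid_add"
  shows "sum f {..<n * k} = (\<Sum>t<n. \<Sum>g<k. f (t * k + g))"
proof -
  have "sum f {t * k..<t * k + k} = (\<Sum>g<k. f (t * k + g))" for t
    using sum.shift_bounds_nat_ivl[of f 0 "t * k" k] by (simp add: lessThan_atLeast0 add.commute)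
  then show ?thesis
    by (simp flip: sum.nat_group)
qed

text \<open>Incidence and joint frequencies are sums of products of such 0/1 indicators, which turns the
  matrix equation into an identity between sums over blocks.\<close>

definition has_level :: "(nat \<Rightarrow> nat set) \<Rightarrow> nat mat \<Rightarrow> nat \<Rightarrow> nat \<Rightarrow> nat \<Rightarrow> int" where
  "has_level S A i p c = of_bool (A $$ (i, c) = level S i p)"

lemma M_block_size_two:
  assumes "dim_col A = b * 2" and row0: "\<And>c. c < b * 2 \<Longrightarrow> A $$ (0, c) = c div 2 + 1"
    and "p < card (S i)" and "j < b"
  shows "M_block b S A i $$ (p, j) = has_level S A i p (j * 2) + has_level S A i p (j * 2 + 1)"
proof -
  have "{c. c < dim_col A \<and> A $$ (i, c) = level S i p \<and> A $$ (0, c) = j + 1}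
      = {c \<in> {j * 2, j * 2 + 1}. A $$ (i, c) = level S i p}"
    using assms by (auto simp: row0)
  also have "int (card \<dots>) = (\<Sum>c\<in>{j * 2, j * 2 + 1}. has_level S A i p c)"
    by (simp add: has_level_def sum.If_cases of_bool_def Int_def)
  finally show ?thesis
    using assms by (simp add: M_block_def)
qed

lemma M_factors_size_two:
  assumes "dim_col A = b * 2" and "p < card (S i)" and "q < card (S j)"
  shows "M_factors S A i j $$ (p, q) =
    (\<Sum>l<b. has_level S A i p (l * 2) * has_level S A j q (l * 2)
        + has_level S A i p (l * 2 + 1) * has_level S A j q (l * 2 + 1))"
proof -
  have "int (card {c. c < b * 2 \<and> A $$ (i, c) = level S i p \<and> A $$ (j, c) = level S j q})
      = (\<Sum>c<b * 2. has_level S A i p c * has_level S A j q c)"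
    by (simp add: has_level_def flip: of_bool_conj)
       (simp add: of_bool_def sum.If_cases Int_def conj_ac)
  also have "\<dots> = (\<Sum>l<b. \<Sum>h<2. has_level S A i p (l * 2 + h) * has_level S A j q (l * 2 + h))"
    by (rule sum_lessThan_times_add)
  finally show ?thesis
    using assms by (simp add: M_factors_def numeral_2_eq_2)
qed

text \<open>Summing \<open>(x + x') (y + y') = 2 (x y + x' y') - (x - x') (y - y')\<close> over the blocks gives on the
  left an entry of \<open>M_block * M_block'\<close> and in the first term on the right the corresponding entry
  of \<open>2 M_factors\<close>, so the sum of the products of contrasts is the defect of orthogonality.\<close>

lemma orthogonal_through_block_contrasts:
  assumes A: "dim_col A = b * 2" and row0: "\<And>c. c < b * 2 \<Longrightarrow> A $$ (0, c) = c div 2 + 1"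
    and contrasts: "\<And>p q. p < card (S i) \<Longrightarrow> q < card (S j) \<Longrightarrow>
      (\<Sum>l<b. (has_level S A i p (l * 2) - has_level S A i p (l * 2 + 1)) *
           (has_level S A j q (l * 2) - has_level S A j q (l * 2 + 1))) = 0"
  shows "orthogonal_through_block b 2 S A i j"
  unfolding orthogonal_through_block_def
proof (rule eq_matI)
  fix p q
  assume "p < dim_row (int 2 \<cdot>\<^sub>m M_factors S A i j)" "q < dim_col (int 2 \<cdot>\<^sub>m M_factors S A i j)"
  then have p: "p < card (S i)" and q: "q < card (S j)"
    by (simp_all add: M_factors_def)
  let ?x = "\<lambda>l h. has_level S A i p (l * 2 + h)" and ?y = "\<lambda>l h. has_level S A j q (l * 2 + h)"
  have "(M_block b S A i * transpose_mat (M_block b S A j)) $$ (p, q)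
      = (\<Sum>l<b. M_block b S A i $$ (p, l) * M_block b S A j $$ (q, l))"
    using p q by (simp add: M_block_def scalar_prod_def lessThan_atLeast0)
  also have "\<dots> = (\<Sum>l<b. (?x l 0 + ?x l 1) * (?y l 0 + ?y l 1))"
    using M_block_size_two[OF A row0] p q by simp
  also have "\<dots> = (\<Sum>l<b. 2 * (?x l 0 * ?y l 0 + ?x l 1 * ?y l 1))
      - (\<Sum>l<b. (?x l 0 - ?x l 1) * (?y l 0 - ?y l 1))"
    by (simp add: algebra_simps flip: sum_subtractf)
  also have "\<dots> = 2 * M_factors S A i j $$ (p, q)"
    using contrasts[OF p q] M_factors_size_two[of A b p S i q j] A p q
    by (simp add: sum_distrib_left)
  finally show "(M_block b S A i * transpose_mat (M_block b S A j)) $$ (p, q)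
      = (int 2 \<cdot>\<^sub>m M_factors S A i j) $$ (p, q)"
    using p q by (simp add: M_factors_def)
qed (simp_all add: M_block_def M_factors_def)

section \<open>Cyclic plans from six initial blocks\<close>

text \<open>The runs in positions \<open>2 g\<close> and \<open>2 g + 1\<close> form one initial block, and the entries of a run
  are the base levels of factors 1, 2 and 3. \<open>None\<close> is the fixed point \<open>\<infinity>\<close>.\<close>

definition initial_runs :: "nat option list list" where
  "initial_runs =
    [[None, Some 0, Some 2], [Some 1, Some 2, None],
     [None, Some 2, None], [Some 1, Some 0, Some 2],
     [Some 0, Some 0, Some 0], [Some 1, None, Some 2],
     [Some 1, None, Some 2], [Some 2, Some 1, Some 0],
     [Some 0, Some 1, Some 2], [Some 2, Some 0, Some 1],
     [Some 0, Some 0, Some 0], [Some 2, Some 1, Some 1]]"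

text \<open>Coding \<open>\<infinity>\<close> as \<open>n\<close>, just above the residues, makes \<open>{0, \<dots>, n}\<close> the level set.\<close>

definition translate :: "nat \<Rightarrow> nat \<Rightarrow> nat option \<Rightarrow> nat" where
  "translate n t u = (case u of None \<Rightarrow> n | Some a \<Rightarrow> (a + t) mod n)"

text \<open>Column \<open>12 t + r\<close> holds run \<open>r\<close> translated by \<open>t\<close>, so that the columns \<open>2 l\<close> and
  \<open>2 l + 1\<close> form a block for every \<open>l\<close>.\<close>

definition cyclic_entry :: "nat \<Rightarrow> nat \<Rightarrow> nat \<Rightarrow> nat" where
  "cyclic_entry n i c = translate n (c div 12) (initial_runs ! (c mod 12) ! (i - 1))"

definition cyclic_plan :: "nat \<Rightarrow> nat mat" where
  "cyclic_plan n =
     mat 4 (12 * n) (\<lambda>(i, c). if i = 0 then c div 2 + 1 else cyclic_entry n i c)"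

definition cyclic_levels :: "nat \<Rightarrow> nat \<Rightarrow> nat set" where
  "cyclic_levels n i = {..n}"

lemma translate_le: "n > 0 \<Longrightarrow> translate n t u \<le> n"
  by (cases u) (simp_all add: translate_def less_imp_le)

lemma level_cyclic:
  assumes "p \<le> n"
  shows "level (cyclic_levels n) i p = p"
proof -
  have "sorted_list_of_set {..n} = [0..<Suc n]"
    by (metis atLeast0AtMost atLeastLessThanSuc_atLeastAtMost sorted_list_of_set_range)
  then show ?thesis
    using assms unfolding level_def cyclic_levels_def by (simp del: upt_Suc)
qed

lemma has_level_cyclic:
  assumes "i \<in> {1..3}" and "p \<le> n" and "c < 12 * n"
  shows "has_level (cyclic_levels n) (cyclic_plan n) i p c = of_bool (cyclic_entry n i c = p)"
  using assms by (simp add: has_level_def cyclic_plan_def level_cyclic)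

text \<open>A product of contrasts mixes the two runs of a block, so \<open>u\<close> and \<open>v\<close> may come from the same
  run or from the two runs of one initial block.\<close>

definition joint_frequency ::
    "nat \<Rightarrow> nat \<Rightarrow> nat \<Rightarrow> nat option \<Rightarrow> nat option \<Rightarrow> int" where
  "joint_frequency n p q u v =
     (\<Sum>t<n. of_bool (translate n t u = p) * of_bool (translate n t v = q))"

text \<open>Raising both base levels by one only reindexes the translations \<open>t\<close> to \<open>t + 1\<close>, and
  translating by \<open>n\<close> is the same as not translating. The point \<open>\<infinity>\<close> is fixed, which is what
  \<open>map_option\<close> expresses.\<close>

lemma joint_frequency_Suc:
  "joint_frequency n p q (map_option Suc u) (map_option Suc v) = joint_frequency n p q u v"
proof -
  let ?f = "\<lambda>t. of_bool (translate n t u = p) * of_bool (translate n t v = q) :: int"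
  have step: "translate n t (map_option Suc w) = translate n (Suc t) w" for t w
    by (simp add: translate_def split: option.split)
  have period: "translate n n w = translate n 0 w" for w
    by (simp add: translate_def split: option.split)
  have "?f 0 + (\<Sum>t<n. ?f (Suc t)) = (\<Sum>t<n. ?f t) + ?f n"
    using sum.lessThan_Suc[of ?f n] sum.lessThan_Suc_shift[of ?f n] by argo
  then show ?thesis
    by (simp add: joint_frequency_def step period)
qed

text \<open>Read as rewrite rules, these lower a pair of base levels until one of them is \<open>0\<close> or both are
  \<open>\<infinity>\<close>; on such normal forms the cancellation between initial blocks is syntactic.\<close>

lemma joint_frequency_shift:
  "joint_frequency n p q (Some (Suc a)) (Some (Suc c)) = joint_frequency n p q (Some a) (Some c)"
  "joint_frequency n p q (Some (Suc a)) None = joint_frequency n p q (Some a) None"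
  "joint_frequency n p q None (Some (Suc c)) = joint_frequency n p q None (Some c)"
  using joint_frequency_Suc[of n p q "Some a" "Some c"]
    joint_frequency_Suc[of n p q "Some a" None] joint_frequency_Suc[of n p q None "Some c"]
  by simp_all

lemma cyclic_plan_orthogonal:
  assumes "n > 0" and i: "i \<in> {1..3}" and j: "j \<in> {1..3}" and "i \<noteq> j"
  shows "orthogonal_through_block (6 * n) 2 (cyclic_levels n) (cyclic_plan n) i j"
proof (rule orthogonal_through_block_contrasts)
  show "dim_col (cyclic_plan n) = 6 * n * 2"
    by (simp add: cyclic_plan_def)
  show "cyclic_plan n $$ (0, c) = c div 2 + 1" if "c < 6 * n * 2" for c
    using that by (simp add: cyclic_plan_def)
  fix p q
  assume "p < card (cyclic_levels n i)" "q < card (cyclic_levels n j)"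
  then have p: "p \<le> n" and q: "q \<le> n"
    by (simp_all add: cyclic_levels_def)
  let ?x = "has_level (cyclic_levels n) (cyclic_plan n) i p"
  let ?y = "has_level (cyclic_levels n) (cyclic_plan n) j q"
  let ?u = "\<lambda>i r. initial_runs ! r ! (i - 1)"
  let ?C = "joint_frequency n p q"
  have runs: "has_level (cyclic_levels n) (cyclic_plan n) i p ((t * 6 + g) * 2 + h)
      = of_bool (translate n t (?u i (g * 2 + h)) = p)"
    if "i \<in> {1..3}" "p \<le> n" "t < n" "g < 6" "h < 2" for i p t g h
  proof -
    have c: "(t * 6 + g) * 2 + h = t * 12 + (g * 2 + h)" and r: "g * 2 + h < 12"
      using that by simp_all
    have "t * 12 + (g * 2 + h) < 12 * n"
      using that by linarith
    moreover have "(t * 12 + r) div 12 = t" "(t * 12 + r) mod 12 = r" if "r < 12" for r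
      using that by simp_all
    note this[OF r]
    ultimately show ?thesis
      unfolding c using that by (simp only: has_level_cyclic cyclic_entry_def)
  qed
  have "(\<Sum>l<6 * n. (?x (l * 2) - ?x (l * 2 + 1)) * (?y (l * 2) - ?y (l * 2 + 1)))
      = (\<Sum>t<n. \<Sum>g<6. (?x ((t * 6 + g) * 2 + 0) - ?x ((t * 6 + g) * 2 + 1))
          * (?y ((t * 6 + g) * 2 + 0) - ?y ((t * 6 + g) * 2 + 1)))"
    by (simp only: mult.commute[of 6 n] sum_lessThan_times_add add_0_right)
  also have "\<dots> = (\<Sum>t<n. \<Sum>g<6.
      (of_bool (translate n t (?u i (g * 2 + 0)) = p) - of_bool (translate n t (?u i (g * 2 + 1)) = p))
      * (of_bool (translate n t (?u j (g * 2 + 0)) = q) - of_bool (translate n t (?u j (g * 2 + 1)) = q)))"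
  proof (intro sum.cong refl)
    fix t g :: nat
    assume "t \<in> {..<n}" "g \<in> {..<6}"
    then show "(?x ((t * 6 + g) * 2 + 0) - ?x ((t * 6 + g) * 2 + 1))
          * (?y ((t * 6 + g) * 2 + 0) - ?y ((t * 6 + g) * 2 + 1))
        = (of_bool (translate n t (?u i (g * 2 + 0)) = p)
            - of_bool (translate n t (?u i (g * 2 + 1)) = p))
          * (of_bool (translate n t (?u j (g * 2 + 0)) = q)
            - of_bool (translate n t (?u j (g * 2 + 1)) = q))"
      using runs[of i p t g 0] runs[of i p t g 1] runs[of j q t g 0] runs[of j q t g 1] i j p q
      by simp
  qed
  also have "\<dots> = (\<Sum>g<6. ?C (?u i (g * 2)) (?u j (g * 2)) - ?C (?u i (g * 2)) (?u j (g * 2 + 1))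
      - ?C (?u i (g * 2 + 1)) (?u j (g * 2)) + ?C (?u i (g * 2 + 1)) (?u j (g * 2 + 1)))"
    by (subst sum.swap)
       (simp add: joint_frequency_def algebra_simps sum.distrib sum_subtractf)
  \<comment> \<open>Normalising the 24 joint frequencies makes them cancel for each of the six pairs of factors.\<close>
  also have "\<dots> = 0"
  proof -
    have "i = 1 \<or> i = 2 \<or> i = 3" "j = 1 \<or> j = 2 \<or> j = 3"
      using i j by auto
    then show ?thesis
      using \<open>i \<noteq> j\<close>
      by (elim disjE; simp add: eval_nat_numeral initial_runs_def joint_frequency_shift)
  qed
  finally show "(\<Sum>l<6 * n. (?x (l * 2) - ?x (l * 2 + 1)) * (?y (l * 2) - ?y (l * 2 + 1))) = 0" .
qed

lemma cyclic_plan_potb: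
  assumes "n > 0"
  shows "potb 3 (6 * n) 2 (cyclic_levels n) (cyclic_plan n)"
proof -
  have block: "card {c. c < 6 * n * 2 \<and> cyclic_plan n $$ (0, c) = j} = 2"
    if j_range: "j \<in> {1..6 * n}" for j
  proof -
    obtain l where j: "j = Suc l" and "l < 6 * n"
      using j_range by (cases j) simp_all
    then have "c < 6 * n * 2 \<and> Suc (c div 2) = j \<longleftrightarrow> c = 2 * l \<or> c = 2 * l + 1" for c
      unfolding j by presburger
    moreover have "cyclic_plan n $$ (0, c) = Suc (c div 2)" if "c < 6 * n * 2" for c
      using that by (simp add: cyclic_plan_def)
    ultimately have "c < 6 * n * 2 \<and> cyclic_plan n $$ (0, c) = j \<longleftrightarrow> c \<in> {2 * l, 2 * l + 1}" for c
      by (metis empty_iff insert_iff)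
    then have "{c. c < 6 * n * 2 \<and> cyclic_plan n $$ (0, c) = j} = {2 * l, 2 * l + 1}"
      by (simp only: Collect_mem_eq)
    then show ?thesis
      by simp
  qed
  have "cyclic_plan n $$ (0, c) \<in> {1..6 * n}" if "c < 6 * n * 2" for c
    using that by (simp add: cyclic_plan_def less_mult_imp_div_less Suc_le_eq)
  moreover have "cyclic_plan n $$ (i, c) \<in> cyclic_levels n i"
    if "i \<in> {1..3}" "c < 6 * n * 2" for i c
    using that translate_le[OF assms] by (simp add: cyclic_plan_def cyclic_entry_def cyclic_levels_def)
  moreover have "cyclic_plan n \<in> carrier_mat (3 + 1) (6 * n * 2)" "finite (cyclic_levels n i)" for i
    by (simp_all add: cyclic_plan_def cyclic_levels_def)
  ultimately have "blocked_mep 3 (6 * n) 2 (cyclic_levels n) (cyclic_plan n)"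
    unfolding blocked_mep_def using assms block by simp
  then show ?thesis
    using cyclic_plan_orthogonal[OF assms] by (simp add: potb_def)
qed

section \<open>The case of six levels\<close>

text \<open>In a balanced design any two treatments already share a block, so balance carries
  connectedness with it.\<close>

lemma bibd_connected_design:
  assumes "bibd v b r k lam Bl" and "lam > 0"
  shows "connected_design (incidence_mat v b Bl)"
  unfolding connected_design_def
proof (intro allI impI)
  let ?N = "incidence_mat v b Bl"
  fix p q
  assume "p < dim_row ?N" "q < dim_row ?N"
  then have p: "p < v" and q: "q < v"
    by (simp_all add: incidence_mat_def)
  show "(p, q) \<in> (adjacent ?N)\<^sup>*"
  proof (cases "p = q")
    case False
    then have "card {j. j < b \<and> p \<in> Bl j \<and> q \<in> Bl j} > 0"
      using assms p q by (simp add: bibd_def)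
    then have "{j. j < b \<and> p \<in> Bl j \<and> q \<in> Bl j} \<noteq> {}"
      by (metis card.empty less_irrefl)
    then obtain j where "j < b" "p \<in> Bl j" "q \<in> Bl j"
      by blast
    then have "(p, q) \<in> adjacent ?N"
      using p q by (auto simp: adjacent_def incidence_mat_def)
    then show ?thesis by blast
  qed simp
qed

definition six_level_block :: "nat \<Rightarrow> nat \<Rightarrow> nat set" where
  "six_level_block i j = {cyclic_entry 5 i (j * 2), cyclic_entry 5 i (j * 2 + 1)}"

lemma card_less_eq_length_filter: "card {j. j < b \<and> P j} = length (filter P [0..<b])"
  using distinct_card[of "filter P [0..<b]"] by (simp add: conj_commute)

text \<open>Modulo \<open>5\<close> the differences \<open>\<plusminus>1\<close> and \<open>\<plusminus>2\<close> are all the nonzero ones, and each of the types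
  \<open>\<infinity>\<close>, \<open>\<plusminus>1\<close> and \<open>\<plusminus>2\<close> labels two of the six initial pairs of each factor. The 30 blocks are few
  enough to be counted by rewriting.\<close>

lemma six_level_block_replications:
  assumes "i \<in> {1..3}" and "p < 6" and "q < 6"
  shows "card {j. j < 30 \<and> p \<in> six_level_block i j \<and> q \<in> six_level_block i j}
    = (if p = q then 10 else 2)"
proof -
  have "\<forall>i\<in>set [1, 2, 3]. \<forall>p\<in>set [0..<6]. \<forall>q\<in>set [0..<6].
      length (filter (\<lambda>j. p \<in> six_level_block i j \<and> q \<in> six_level_block i j) [0..<30])
        = (if p = q then 10 else 2)"
    by code_simp
  moreover have "i \<in> set [1, 2, 3]" "p \<in> set [0..<6]" "q \<in> set [0..<6]"
    using assms by auto
  ultimately show ?thesis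
    unfolding card_less_eq_length_filter by blast
qed

lemma six_level_block_distinct:
  assumes "i \<in> {1..3}" and "j < 30"
  shows "cyclic_entry 5 i (j * 2) \<noteq> cyclic_entry 5 i (j * 2 + 1)"
proof -
  have "\<forall>i\<in>set [1, 2, 3]. \<forall>j\<in>set [0..<30].
      cyclic_entry 5 i (j * 2) \<noteq> cyclic_entry 5 i (j * 2 + 1)"
    by code_simp
  moreover have "i \<in> set [1, 2, 3]" "j \<in> set [0..<30]"
    using assms by auto
  ultimately show ?thesis
    by blast
qed

lemma six_level_bibd:
  assumes i: "i \<in> {1..3}"
  shows "bibd 6 30 10 2 2 (six_level_block i)"
  unfolding bibd_def
proof (intro conjI allI impI)
  fix j :: nat
  assume j: "j < 30"
  show "six_level_block i j \<subseteq> {..<6}"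
    using translate_le[of 5, THEN le_imp_less_Suc] by (simp add: six_level_block_def cyclic_entry_def)
  show "card (six_level_block i j) = 2"
    using six_level_block_distinct[OF i j] by (simp add: six_level_block_def)
next
  fix p :: nat
  assume "p < 6"
  then show "card {j. j < 30 \<and> p \<in> six_level_block i j} = 10"
    using six_level_block_replications[OF i, of p p] by simp
next
  fix p q :: nat
  assume "p < 6" "q < 6" "p \<noteq> q"
  then show "card {j. j < 30 \<and> p \<in> six_level_block i j \<and> q \<in> six_level_block i j} = 2"
    using six_level_block_replications[OF i] by simp
qed simp_all

lemma M_block_six_levels:
  assumes i: "i \<in> {1..3}"
  shows "M_block 30 (cyclic_levels 5) (cyclic_plan 5) i = incidence_mat 6 30 (six_level_block i)"
proof (rule eq_matI)
  fix p j
  assume "p < dim_row (incidence_mat 6 30 (six_level_block i))"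
    and "j < dim_col (incidence_mat 6 30 (six_level_block i))"
  then have p: "p < 6" and j: "j < 30"
    by (simp_all add: incidence_mat_def)
  have dim: "dim_col (cyclic_plan 5) = 30 * 2"
    by (simp add: cyclic_plan_def)
  have row0: "cyclic_plan 5 $$ (0, c) = c div 2 + 1" if "c < 30 * 2" for c
    using that by (simp add: cyclic_plan_def)
  have "p < card (cyclic_levels 5 i)"
    using p by (simp add: cyclic_levels_def)
  from M_block_size_two[of "cyclic_plan 5" 30 p "cyclic_levels 5" i j, OF dim row0 this j]
  have "M_block 30 (cyclic_levels 5) (cyclic_plan 5) i $$ (p, j)
      = of_bool (cyclic_entry 5 i (j * 2) = p) + of_bool (cyclic_entry 5 i (j * 2 + 1) = p)"
    using i p j by (simp add: has_level_cyclic)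
  also have "\<dots> = incidence_mat 6 30 (six_level_block i) $$ (p, j)"
    using six_level_block_distinct[OF i j] p j by (auto simp: incidence_mat_def six_level_block_def)
  finally show "M_block 30 (cyclic_levels 5) (cyclic_plan 5) i $$ (p, j)
      = incidence_mat 6 30 (six_level_block i) $$ (p, j)" .
qed (simp_all add: M_block_def incidence_mat_def cyclic_levels_def)

lemma six_level_balanced: "balanced_potb 3 30 2 (cyclic_levels 5) (cyclic_plan 5)"
proof -
  have P: "potb 3 30 2 (cyclic_levels 5) (cyclic_plan 5)"
    using cyclic_plan_potb[of 5] by simp
  have "connected_design (M_block 30 (cyclic_levels 5) (cyclic_plan 5) i)"
    and "bibd (card (cyclic_levels 5 i)) 30 10 2 2 (six_level_block i)"
    and "M_block 30 (cyclic_levels 5) (cyclic_plan 5) i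
      = incidence_mat (card (cyclic_levels 5 i)) 30 (six_level_block i)"
    if "i \<in> {1..3}" for i
    using bibd_connected_design[OF six_level_bibd] six_level_bibd M_block_six_levels that
    by (simp_all add: cyclic_levels_def)
  with P show ?thesis
    unfolding balanced_potb_def connected_mep_def potb_def by blast
qed

text \<open>The products are the off-diagonal entries of \<open>M' M = f I + g J\<close>, all equal to \<open>g\<close>.\<close>

lemma pergola_column_products:
  assumes "pergola b k S A" and s: "card (S 1) = s"
    and "p < s" "q < s" "p \<noteq> q" "p' < s" "q' < s" "p' \<noteq> q'"
  defines "M \<equiv> M_factors S A 1 2"
  shows "(\<Sum>r<s. M $$ (r, p) * M $$ (r, q)) = (\<Sum>r<s. M $$ (r, p') * M $$ (r, q'))"
proof -
  obtain f g where "card (S 2) = s"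
    and gram: "transpose_mat M * M = f \<cdot>\<^sub>m 1\<^sub>m s + g \<cdot>\<^sub>m mat s s (\<lambda>_. 1)"
    using assms(1) s unfolding pergola_def Let_def M_def by blast
  then have M: "M \<in> carrier_mat s s"
    using s by (simp add: M_def M_factors_def)
  have "(\<Sum>r<s. M $$ (r, p) * M $$ (r, q)) = g" if "p < s" "q < s" "p \<noteq> q" for p q
  proof -
    have "(\<Sum>r<s. M $$ (r, p) * M $$ (r, q)) = (transpose_mat M * M) $$ (p, q)"
      using M that by (simp add: scalar_prod_def lessThan_atLeast0)
    also have "\<dots> = g"
      using that by (simp add: gram)
    finally show ?thesis .
  qed
  then show ?thesis
    using assms by simp
qed

definition six_level_frequency :: "nat \<Rightarrow> nat \<Rightarrow> nat \<Rightarrow> nat \<Rightarrow> nat" where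
  "six_level_frequency i j p q =
     length (filter (\<lambda>c. cyclic_entry 5 i c = p \<and> cyclic_entry 5 j c = q) [0..<60])"

lemma M_factors_six_levels:
  assumes "i \<in> {1..3}" "j \<in> {1..3}" "p < 6" "q < 6"
  shows "M_factors (cyclic_levels 5) (cyclic_plan 5) i j $$ (p, q) = int (six_level_frequency i j p q)"
proof -
  have "{c. c < 60 \<and> cyclic_plan 5 $$ (i, c) = p \<and> cyclic_plan 5 $$ (j, c) = q}
      = {c. c < 60 \<and> cyclic_entry 5 i c = p \<and> cyclic_entry 5 j c = q}"
    using assms by (auto simp: cyclic_plan_def)
  moreover have "dim_col (cyclic_plan 5) = 60" "card (cyclic_levels 5 l) = 6" for l
    by (simp_all add: cyclic_plan_def cyclic_levels_def)
  moreover have "level (cyclic_levels 5) i p = p" "level (cyclic_levels 5) j q = q"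
    using assms by (simp_all add: level_cyclic)
  ultimately show ?thesis
    using assms
    by (simp add: M_factors_def six_level_frequency_def flip: card_less_eq_length_filter)
qed

text \<open>The left side is \<open>17\<close> for every pair of factors. The level \<open>5\<close> is \<open>\<infinity>\<close>, and the right side
  is \<open>14\<close> for factors 1 and 3 and \<open>16\<close> otherwise.\<close>

lemma six_level_column_products:
  assumes "(i, j) \<in> {(1, 2), (1, 3), (2, 3)}"
  shows "(\<Sum>p<6. six_level_frequency i j p 0 * six_level_frequency i j p 1)
    \<noteq> (\<Sum>p<6. six_level_frequency i j p 0 * six_level_frequency i j p 5)"
proof -
  have "\<forall>(i, j)\<in>set [(1, 2), (1, 3), (2, 3)].
    sum_list (map (\<lambda>p. six_level_frequency i j p 0 * six_level_frequency i j p 1) [0..<6])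
    \<noteq> sum_list (map (\<lambda>p. six_level_frequency i j p 0 * six_level_frequency i j p 5) [0..<6])"
    by code_simp
  then show ?thesis
    using assms by (auto simp: sum_list_distinct_conv_sum_set atLeast0LessThan simp del: upt_Suc)
qed

lemma six_level_not_pergola:
  assumes l: "l \<in> {1..3}"
  shows "\<not> pergola 30 2 (drop_levels l (cyclic_levels 5)) (drop_row l (cyclic_plan 5))"
proof
  let ?S = "drop_levels l (cyclic_levels 5)" and ?A = "drop_row l (cyclic_plan 5)"
  assume P: "pergola 30 2 ?S ?A"
  have factors: "(skip l 1, skip l 2) \<in> {(1, 2), (1, 3), (2, 3)}"
    using l by (auto simp: skip_def)
  then have range: "skip l 1 \<in> {1..3}" "skip l 2 \<in> {1..3}"
    by auto
  have carrier: "cyclic_plan 5 \<in> carrier_mat (2 + 2) 60"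
    by (simp add: cyclic_plan_def)
  have M: "M_factors ?S ?A 1 2 $$ (p, q)
      = int (six_level_frequency (skip l 1) (skip l 2) p q)" if "p < 6" "q < 6" for p q
    using M_factors_drop[OF carrier, of 1 2 l "cyclic_levels 5"] M_factors_six_levels[OF range] that
    by simp
  let ?f = "six_level_frequency (skip l 1) (skip l 2)"
  have products: "(\<Sum>r<6. M_factors ?S ?A 1 2 $$ (r, p) * M_factors ?S ?A 1 2 $$ (r, q))
      = int (\<Sum>r<6. ?f r p * ?f r q)" if "p < 6" "q < 6" for p q
  proof -
    have "(\<Sum>r<6. M_factors ?S ?A 1 2 $$ (r, p) * M_factors ?S ?A 1 2 $$ (r, q))
        = (\<Sum>r<6. int (?f r p) * int (?f r q))"
      using M that by (intro sum.cong refl) (simp only: lessThan_iff)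
    then show ?thesis
      by (simp only: of_nat_sum of_nat_mult)
  qed
  have "card (?S 1) = 6"
    by (simp add: drop_levels_def cyclic_levels_def)
  from pergola_column_products[OF P this, of 0 1 0 5]
  have "(\<Sum>r<6. M_factors ?S ?A 1 2 $$ (r, 0) * M_factors ?S ?A 1 2 $$ (r, 1))
      = (\<Sum>r<6. M_factors ?S ?A 1 2 $$ (r, 0) * M_factors ?S ?A 1 2 $$ (r, 5))"
    by simp
  then have "int (\<Sum>r<6. ?f r 0 * ?f r 1) = int (\<Sum>r<6. ?f r 0 * ?f r 5)"
    using products[of 0 1] products[of 0 5] by linarith
  then show False
    using six_level_column_products[OF factors] by (simp only: of_nat_eq_iff)
qed

theorem theorem3p1:
  fixes n :: nat
  assumes "n \<ge> 5"
  shows "(\<exists>S A. potb 3 (6 * n) 2 S A \<and> (\<forall>i\<in>{1..3}. card (S i) = n + 1)) \<and>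
         (\<exists>S A. balanced_potb 3 30 2 S A \<and> (\<forall>i\<in>{1..3}. card (S i) = 6) \<and>
            (\<forall>l\<in>{1..3}. \<not> pergola 30 2 (drop_levels l S) (drop_row l A)))"
proof -
  have "card (cyclic_levels m i) = m + 1" for m i
    by (simp add: cyclic_levels_def)
  moreover have "potb 3 (6 * n) 2 (cyclic_levels n) (cyclic_plan n)"
    using assms by (intro cyclic_plan_potb) simp
  ultimately show ?thesis
    using six_level_balanced six_level_not_pergola
    by (intro conjI exI[of _ "cyclic_levels n"] exI[of _ "cyclic_plan n"]
        exI[of _ "cyclic_levels 5"] exI[of _ "cyclic_plan 5"]) simp_all
qed

end
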